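(* Let $n\geq 3$. The adjacency algebra of the folded $n$-cube contains a complex Hadamard matrix if and only if $n$ is odd.
   Context: The folded $n$-cube is the graph obtained from the $n$-cube (vertex set $\{0,1\}^n$, adjacency when words differ in one coordinate) by identifying each word $a$ with its complement $a\oplus \mathbf{1}$; equivalently, it is the graph obtained from the $(n-1)$-cube by adding the edges $\{a, a\oplus\mathbf{1}\}$. It is distance-regular on $2^{n-1}$ vertices. The adjacency algebra of a graph is the complex algebra spanned by the powers of its adjacency matrix. A $v\times v$ matrix $W$ with nonzero entries is type II if $\sum_{c=1}^v W_{ac}/W_{bc}$ equals $v$ when $a=b$ and $0$ otherwise; a complex Hadamard matrix is a type II matrix all of whose entries have absolute value $1$. *)

theory Defs
  imports "Jordan_Normal_Form.VS_Connect"
begin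

definition words :: "nat \<Rightarrow> bool list set" where
  "words n = {a. length a = n}"

definition cube_adj :: "bool list \<Rightarrow> bool list \<Rightarrow> bool" where
  "cube_adj a b \<longleftrightarrow> length a = length b \<and> card {i. i < length a \<and> a ! i \<noteq> b ! i} = 1"

definition complement_rel :: "nat \<Rightarrow> (bool list \<times> bool list) set" where
  "complement_rel n = {(a, b). a \<in> words n \<and> (b = a \<or> b = map Not a)}"

definition folded_cube_verts :: "nat \<Rightarrow> bool list set set" where
  "folded_cube_verts n = words n // complement_rel n"

(* This is the edge relation of the quotient graph. For n \<ge> 2 it has no loops, since a word and
   its complement then differ in more than one coordinate. *)
definition folded_cube_adj :: "bool list set \<Rightarrow> bool list set \<Rightarrow> bool" where
  "folded_cube_adj X Y \<longleftrightarrow> (\<exists>a\<in>X. \<exists>b\<in>Y. cube_adj a b)"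

(* The list vs enumerates the vertices of the graph; row and column i belong to the vertex vs ! i. *)
definition adjacency_matrix :: "'v list \<Rightarrow> ('v \<Rightarrow> 'v \<Rightarrow> bool) \<Rightarrow> complex mat" where
  "adjacency_matrix vs adj =
     mat (length vs) (length vs) (\<lambda>(i, j). if adj (vs ! i) (vs ! j) then 1 else 0)"

(* The complex linear span of the powers of A, including A^0, the identity matrix. *)
definition adjacency_algebra :: "complex mat \<Rightarrow> complex mat set" where
  "adjacency_algebra A =
     LinearCombinations.module.span class_ring (module_mat TYPE(complex) (dim_row A) (dim_row A))
       (range (\<lambda>k. A ^\<^sub>m k))"

definition type_II :: "complex mat \<Rightarrow> bool" where
  "type_II W \<longleftrightarrow> square_mat W \<and>
     (\<forall>a<dim_row W. \<forall>b<dim_row W. W $$ (a, b) \<noteq> 0) \<and>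
     (\<forall>a<dim_row W. \<forall>b<dim_row W.
        (\<Sum>c<dim_row W. W $$ (a, c) / W $$ (b, c)) = (if a = b then of_nat (dim_row W) else 0))"

definition complex_hadamard :: "complex mat \<Rightarrow> bool" where
  "complex_hadamard W \<longleftrightarrow> type_II W \<and>
     (\<forall>a<dim_row W. \<forall>b<dim_row W. cmod (W $$ (a, b)) = 1)"

lemma equiv_complement_rel: "equiv (words n) (complement_rel n)"
  by (rule equivI)
    (auto simp: complement_rel_def words_def refl_on_def sym_def trans_def comp_def)

lemma folded_cube_verts_eq: "folded_cube_verts n = (\<lambda>a. {a, map Not a}) ` words n"
  by (auto simp: folded_cube_verts_def quotient_def complement_rel_def)

lemma finite_folded_cube_verts: "finite (folded_cube_verts n)"
proof -
  have "words n = {a. set a \<subseteq> UNIV \<and> length a = n}"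
    by (simp add: words_def)
  then have "finite (words n)"
    using finite_lists_length_eq[of "UNIV :: bool set" n] by simp
  then show ?thesis
    by (simp add: folded_cube_verts_eq)
qed

lemma adjacency_algebra_iff:
  assumes A: "A \<in> carrier_mat v v"
  shows "W \<in> adjacency_algebra A \<longleftrightarrow>
    W \<in> carrier_mat v v \<and>
    (\<exists>m c. \<forall>i<v. \<forall>j<v. W $$ (i, j) = (\<Sum>k<m. c k * (A ^\<^sub>m k) $$ (i, j)))"
proof -
  let ?M = "module_mat TYPE(complex) v v"
  interpret V: vectorspace "class_ring :: complex ring" ?M
    by (rule matrix_vs)
  let ?P = "range (\<lambda>k. A ^\<^sub>m k)"
  have alg: "adjacency_algebra A = V.span ?P"
    using A by (simp add: adjacency_algebra_def)
  have pow: "A ^\<^sub>m k \<in> carrier_mat v v" for k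
    using A by simp
  have P: "?P \<subseteq> carrier ?M"
    using pow by (auto simp: module_mat_simps)
  have lin: "V.lincomb a F \<in> carrier_mat v v \<and>
      (\<forall>i<v. \<forall>j<v. V.lincomb a F $$ (i, j) = (\<Sum>X\<in>F. a X * X $$ (i, j)))"
    if "finite F" "F \<subseteq> carrier_mat v v" for a F
    using that
  proof (induction F)
    case empty
    then show ?case by (simp add: V.lincomb_def module_mat_simps)
  next
    case (insert X F)
    have "V.lincomb a (insert X F) = a X \<cdot>\<^sub>m X + V.lincomb a F"
      unfolding V.lincomb_def
      using insert by (subst V.finsum_insert) (auto simp: module_mat_simps)
    then show ?case using insert by auto
  qed
  show ?thesis
  proof
    assume "W \<in> adjacency_algebra A"
    then obtain a F where F: "finite F" "F \<subseteq> ?P" and W: "W = V.lincomb a F"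
      unfolding alg V.span_def by blast
    obtain K where inj: "inj_on (\<lambda>k. A ^\<^sub>m k) K" and FK: "F = (\<lambda>k. A ^\<^sub>m k) ` K"
      using F(2) by (auto simp: subset_image_inj)
    have K: "finite K"
      using F(1) FK inj finite_image_iff by blast
    have FM: "F \<subseteq> carrier_mat v v"
      using FK pow by auto
    define m where "m = Suc (Max K)"
    have Km: "K \<subseteq> {..<m}"
      using K Max_ge by (auto simp: m_def less_Suc_eq_le)
    define c where "c k = (if k \<in> K then a (A ^\<^sub>m k) else 0)" for k
    have "W $$ (i, j) = (\<Sum>k<m. c k * (A ^\<^sub>m k) $$ (i, j))" if "i < v" "j < v" for i j
    proof -
      have "W $$ (i, j) = (\<Sum>X\<in>F. a X * X $$ (i, j))"
        using lin[OF F(1) FM, of a] W that by simp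
      also have "\<dots> = (\<Sum>k\<in>K. a (A ^\<^sub>m k) * (A ^\<^sub>m k) $$ (i, j))"
        unfolding FK by (simp add: sum.reindex[OF inj])
      also have "\<dots> = (\<Sum>k<m. c k * (A ^\<^sub>m k) $$ (i, j))"
        by (rule sum.mono_neutral_cong_left) (use Km in \<open>auto simp: c_def\<close>)
      finally show ?thesis .
    qed
    then show "W \<in> carrier_mat v v \<and>
      (\<exists>m c. \<forall>i<v. \<forall>j<v. W $$ (i, j) = (\<Sum>k<m. c k * (A ^\<^sub>m k) $$ (i, j)))"
      using lin[OF F(1) FM, of a] W by blast
  next
    assume "W \<in> carrier_mat v v \<and>
      (\<exists>m c. \<forall>i<v. \<forall>j<v. W $$ (i, j) = (\<Sum>k<m. c k * (A ^\<^sub>m k) $$ (i, j)))"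
    then obtain m c where WM: "W \<in> carrier_mat v v"
      and W: "\<And>i j. i < v \<Longrightarrow> j < v \<Longrightarrow> W $$ (i, j) = (\<Sum>k<m. c k * (A ^\<^sub>m k) $$ (i, j))"
      by blast
    define B where "B m = mat v v (\<lambda>(i, j). \<Sum>k<m. c k * (A ^\<^sub>m k) $$ (i, j))" for m
    interpret S: submodule "class_ring :: complex ring" "V.span ?P" ?M
      by (rule V.span_is_submodule[OF P])
    have "B m \<in> V.span ?P"
    proof (induction m)
      case 0
      have "B 0 = 0\<^sub>m v v"
        by (auto simp: B_def)
      then show ?case
        using S.zero_closed by (simp add: module_mat_simps)
    next
      case (Suc m)
      have "B (Suc m) = B m + c m \<cdot>\<^sub>m (A ^\<^sub>m m)"
        using A pow[of m] by (intro eq_matI) (auto simp: B_def split: if_splits)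
      moreover have "A ^\<^sub>m m \<in> V.span ?P"
        using V.in_own_span[OF P] by auto
      ultimately show ?case
        using Suc S.m_closed S.smult_closed[of "c m" "A ^\<^sub>m m"] 
        by (simp add: module_mat_simps class_ring_simps)
    qed
    moreover have "W = B m"
      using WM W by (auto simp: B_def)
    ultimately show "W \<in> adjacency_algebra A"
      by (simp add: alg)
  qed
qed

end

(* A matrix W in the algebra has entries w (ham x y) for a function w on {0..n} with
   w (n - d) = w d. Orthogonality of two rows at distance 2 forces w (d + 2) = - w d, which is
   incompatible with the reflection d -> n - d when n is even. For odd n these two conditions
   have a common solution with values 1 and -1. It gives orthogonal rows, and it lies in the
   algebra because the distance matrices satisfy a three-term recurrence under multiplication
   by the adjacency matrix. *)
theory Submission
  imports Defs
begin

section \<open>Hamming distance, coordinate flips and complementary pairs\<close>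

definition ham :: "bool list \<Rightarrow> bool list \<Rightarrow> nat" where
  "ham a b = card {i. i < length a \<and> a ! i \<noteq> b ! i}"

abbreviation flip :: "nat \<Rightarrow> bool list \<Rightarrow> bool list" where
  "flip t a \<equiv> a[t := \<not> a ! t]"

abbreviation fold_class :: "bool list \<Rightarrow> bool list set" where
  "fold_class a \<equiv> {a, map Not a}"

lemma map_Not_Not [simp]: "map Not (map Not a) = a"
  by (simp add: comp_def)

lemma fold_class_eq_iff: "fold_class a = fold_class b \<longleftrightarrow> a = b \<or> a = map Not b"
  by (auto simp: doubleton_eq_iff comp_def)

lemma flip_map_Not: "t < length a \<Longrightarrow> flip t (map Not a) = map Not (flip t a)"
  by (simp add: map_update)

lemma finite_words [simp]: "finite (words n)"
  using finite_lists_length_eq[of "UNIV :: bool set" n] by (simp add: words_def)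

lemma ham_commute: "length a = length b \<Longrightarrow> ham a b = ham b a"
  unfolding ham_def by (rule arg_cong[of _ _ card]) auto

lemma ham_le: "ham a b \<le> length a"
  unfolding ham_def by (rule order_trans[OF card_mono[of "{..<length a}"]]) auto

lemma ham_eq_0_iff: "length a = length b \<Longrightarrow> ham a b = 0 \<longleftrightarrow> a = b"
  by (auto simp: ham_def list_eq_iff_nth_eq)

lemma ham_map_Not:
  assumes "length a = length b"
  shows "ham a (map Not b) = length a - ham a b"
proof -
  have "{i. i < length a \<and> a ! i \<noteq> map Not b ! i} = {..<length a} - {i. i < length a \<and> a ! i \<noteq> b ! i}"
    using assms by auto
  then show ?thesis
    unfolding ham_def by (simp add: card_Diff_subset subset_eq)
qed

lemma ham_flip_eq:
  assumes "length a = length b" "t < length b" "a ! t = b ! t"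
  shows "ham a (flip t b) = Suc (ham a b)"
proof -
  have "{i. i < length a \<and> a ! i \<noteq> flip t b ! i} = insert t {i. i < length a \<and> a ! i \<noteq> b ! i}"
    using assms by (auto simp: nth_list_update split: if_splits)
  then show ?thesis
    using assms by (simp add: ham_def)
qed

lemma ham_flip_neq:
  assumes "length a = length b" "t < length b" "a ! t \<noteq> b ! t"
  shows "Suc (ham a (flip t b)) = ham a b"
  using ham_flip_eq[of a "flip t b" t] assms by (simp add: list_update_same_conv[THEN iffD2])

lemma cube_adj_iff_flip:
  "cube_adj a b \<longleftrightarrow> length a = length b \<and> (\<exists>t<length b. a = flip t b)"
proof
  assume *: "cube_adj a b"
  then have len: "length a = length b"
    by (simp add: cube_adj_def)
  from * obtain t where t: "{i. i < length a \<and> a ! i \<noteq> b ! i} = {t}"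
    by (auto simp: cube_adj_def card_1_singleton_iff)
  then have "t < length b" "a ! t \<noteq> b ! t"
    using len by auto
  moreover have "a = flip t b"
  proof (rule nth_equalityI)
    fix i assume "i < length a"
    then show "a ! i = flip t b ! i"
      using t len by (cases "i = t") (auto simp: nth_list_update)
  qed (use len in simp)
  ultimately show "length a = length b \<and> (\<exists>t<length b. a = flip t b)"
    using len by blast
next
  assume "length a = length b \<and> (\<exists>t<length b. a = flip t b)"
  then obtain t where t: "t < length b" "a = flip t b" by blast
  then have "{i. i < length a \<and> a ! i \<noteq> b ! i} = {t}"
    by (auto simp: nth_list_update split: if_splits)
  then show "cube_adj a b"
    using t by (simp add: cube_adj_def)
qed

section \<open>Neighbours in the folded cube\<close>

text \<open>Adjacency allows four choices of representatives. Flipping commutes with complementing,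
  so one fixed \<open>b\<close> suffices and the neighbours are indexed by coordinates.\<close>

lemma folded_cube_adj_iff:
  assumes "length a = n" "length b = n"
  shows "folded_cube_adj (fold_class a) (fold_class b)
    \<longleftrightarrow> (\<exists>t<n. fold_class a = fold_class (flip t b))"
proof -
  have "folded_cube_adj (fold_class a) (fold_class b) \<longleftrightarrow>
    (\<exists>t<n. a = flip t b \<or> map Not a = flip t b \<or>
      a = flip t (map Not b) \<or> map Not a = flip t (map Not b))"
    using assms by (auto simp: folded_cube_adj_def cube_adj_iff_flip)
  also have "\<dots> \<longleftrightarrow> (\<exists>t<n. a = flip t b \<or> a = map Not (flip t b))"
    using assms by (metis flip_map_Not map_Not_Not)
  finally show ?thesis
    by (simp only: fold_class_eq_iff)
qed

text \<open>For \<open>n = 2\<close> the two flips of \<open>b\<close> are complementary. A third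
  coordinate \<open>r\<close>, where both flipped words agree with \<open>b\<close>, excludes
  this.\<close>

lemma inj_on_fold_class_flip:
  assumes "length b = n" "n \<ge> 3"
  shows "inj_on (\<lambda>t. fold_class (flip t b)) {..<n}"
proof (rule inj_onI)
  fix s t assume st: "s \<in> {..<n}" "t \<in> {..<n}"
    and "fold_class (flip s b) = fold_class (flip t b)"
  then have *: "flip s b = flip t b \<or> flip s b = map Not (flip t b)"
    by (simp only: fold_class_eq_iff)
  show "s = t"
  proof (rule ccontr)
    assume neq: "s \<noteq> t"
    obtain r where r: "r < n" "r \<noteq> s" "r \<noteq> t"
    proof -
      have "\<not> {..<n} \<subseteq> {s, t}"
        using card_mono[of "{s, t}" "{..<n}"] neq assms by auto
      then show ?thesis using that by auto
    qed
    from * show False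
    proof
      assume "flip s b = flip t b"
      then have "flip s b ! s = flip t b ! s" by simp
      then show False using st neq assms by simp
    next
      assume "flip s b = map Not (flip t b)"
      then have "flip s b ! r = map Not (flip t b) ! r" by simp
      then show False using r assms by simp
    qed
  qed
qed

section \<open>Powers of the adjacency matrix and walk counts\<close>

text \<open>\<^term>\<open>walk n k d\<close> is the number of walks of length \<^term>\<open>k\<close> between two vertices of the
  folded cube represented by words at Hamming distance \<^term>\<open>d\<close>.\<close>

fun walk :: "nat \<Rightarrow> nat \<Rightarrow> nat \<Rightarrow> complex" where
  "walk n 0 d = (if d = 0 \<or> d = n then 1 else 0)"
| "walk n (Suc k) d = of_nat d * walk n k (d - 1) + of_nat (n - d) * walk n k (Suc d)"

text \<open>Complementing one representative turns \<open>d\<close> into \<open>n - d\<close>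
  without changing the vertex. In the induction the two terms of the recurrence change places; at
  \<open>d = 0\<close> and \<open>d = n\<close> the argument that would leave the range has factor
  0.\<close>

lemma walk_reflect: "d \<le> n \<Longrightarrow> walk n k (n - d) = walk n k d"
proof (induction k arbitrary: d)
  case 0
  then show ?case by auto
next
  case (Suc k)
  have 1: "of_nat (n - d) * walk n k (n - d - 1) = of_nat (n - d) * walk n k (Suc d)"
  proof (cases "d = n")
    case False
    then show ?thesis using Suc.IH[of "Suc d"] Suc.prems by simp
  qed simp
  have 2: "of_nat d * walk n k (Suc (n - d)) = of_nat d * walk n k (d - 1)"
  proof (cases "d = 0")
    case False
    then show ?thesis using Suc.IH[of "d - 1"] Suc.prems by (simp add: Suc_diff_le)
  qed simp
  show ?case using 1 2 Suc.prems by (auto simp: algebra_simps)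
qed

text \<open>A flip lowers the distance at each of the \<open>ham x y\<close> positions where the
  words differ and raises it at the others. This is the recurrence of \<open>walk\<close>.\<close>

lemma sum_ham_flip:
  fixes f :: "nat \<Rightarrow> complex"
  assumes "length x = n" "length y = n"
  shows "(\<Sum>t<n. f (ham x (flip t y))) =
    of_nat (ham x y) * f (ham x y - 1) + of_nat (n - ham x y) * f (Suc (ham x y))"
proof -
  let ?D = "{i. i < length x \<and> x ! i \<noteq> y ! i}"
  have "(\<Sum>t<n. f (ham x (flip t y))) =
      (\<Sum>t\<in>{..<n} - ?D. f (ham x (flip t y))) + (\<Sum>t\<in>?D. f (ham x (flip t y)))"
    by (rule sum.subset_diff) (use assms in auto)
  also have "(\<Sum>t\<in>?D. f (ham x (flip t y))) = (\<Sum>t\<in>?D. f (ham x y - 1))"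
    by (rule sum.cong[OF refl], rule arg_cong[of _ _ f]) (use assms ham_flip_neq[of x y] in fastforce)
  also have "(\<Sum>t\<in>{..<n} - ?D. f (ham x (flip t y))) = (\<Sum>t\<in>{..<n} - ?D. f (Suc (ham x y)))"
    by (rule sum.cong[OF refl], rule arg_cong[of _ _ f]) (use assms ham_flip_eq[of x y] in auto)
  also have "card ({..<n} - ?D) = n - ham x y"
    unfolding ham_def by (subst card_Diff_subset) (use assms in auto)
  ultimately show ?thesis
    by (simp add: ham_def)
qed

lemma vertex_rep:
  assumes "set vs = folded_cube_verts n" "i < length vs"
  obtains x where "length x = n" "vs ! i = fold_class x"
  using assms nth_mem[of i vs] by (auto simp: folded_cube_verts_eq words_def)

lemma vertex_index:
  assumes "set vs = folded_cube_verts n" "length x = n"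
  obtains i where "i < length vs" "vs ! i = fold_class x"
proof -
  have "fold_class x \<in> set vs"
    using assms by (auto simp: folded_cube_verts_eq words_def)
  then show ?thesis using that by (metis in_set_conv_nth)
qed

lemma pow_adjacency_matrix_entry:
  assumes n: "n \<ge> 3" and vs: "distinct vs" "set vs = folded_cube_verts n"
    and ij: "i < length vs" "j < length vs"
    and xy: "length x = n" "length y = n" "vs ! i = fold_class x" "vs ! j = fold_class y"
  shows "(adjacency_matrix vs folded_cube_adj ^\<^sub>m k) $$ (i, j) = walk n k (ham x y)"
  using ij(2) xy(2,4)
proof (induction k arbitrary: j y)
  case 0
  have "i = j \<longleftrightarrow> vs ! i = vs ! j"
    using vs(1) ij(1) 0(1) by (simp add: nth_eq_iff_index_eq)
  also have "\<dots> \<longleftrightarrow> x = y \<or> x = map Not y"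
    unfolding xy(3) 0(3) by (rule fold_class_eq_iff)
  also have "\<dots> \<longleftrightarrow> ham x y = 0 \<or> ham x (map Not y) = 0"
    using ham_eq_0_iff[of x y] ham_eq_0_iff[of x "map Not y"] xy(1) 0(2) by simp
  also have "\<dots> \<longleftrightarrow> ham x y = 0 \<or> ham x y = n"
    using ham_map_Not[of x y] ham_le[of x y] xy(1) 0(2) by auto
  finally show ?case
    using ij(1) 0(1) by (simp add: adjacency_matrix_def)
next
  case (Suc k)
  let ?A = "adjacency_matrix vs folded_cube_adj" and ?v = "length vs"
  let ?N = "{c. c < ?v \<and> folded_cube_adj (vs ! c) (vs ! j)}"
  have A: "?A \<in> carrier_mat ?v ?v"
    by (simp add: adjacency_matrix_def)
  have Ak: "?A ^\<^sub>m k \<in> carrier_mat ?v ?v"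
    using A by simp
  \<comment> \<open>\<open>idx t\<close> is the row index of the neighbour obtained by flipping
    coordinate \<open>t\<close>; it turns the sum over adjacent vertices into a sum over
    \<open>t < n\<close>.\<close>
  have "\<exists>c<?v. vs ! c = fold_class (flip t y)" for t
    using vertex_index[OF vs(2), of "flip t y"] Suc.prems(2) by auto
  then obtain idx where idx: "\<And>t. idx t < ?v" "\<And>t. vs ! idx t = fold_class (flip t y)"
    by metis
  have inj: "inj_on idx {..<n}"
    using inj_on_fold_class_flip[OF Suc.prems(2) n] idx(2) unfolding inj_on_def by metis
  have N: "?N = idx ` {..<n}"
  proof (intro equalityI subsetI)
    fix c assume c: "c \<in> ?N"
    then obtain z where z: "length z = n" "vs ! c = fold_class z"
      using vertex_rep[OF vs(2), of c] by auto
    then obtain t where t: "t < n" "fold_class z = fold_class (flip t y)"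
      using c folded_cube_adj_iff[OF z(1) Suc.prems(2)] Suc.prems(3) by auto
    then have "vs ! c = vs ! idx t"
      using idx(2) z(2) by simp
    then have "c = idx t"
      using c idx(1) vs(1) by (simp add: nth_eq_iff_index_eq)
    then show "c \<in> idx ` {..<n}"
      using t(1) by simp
  next
    fix c assume "c \<in> idx ` {..<n}"
    then obtain t where t: "t < n" "c = idx t" by auto
    have "folded_cube_adj (fold_class (flip t y)) (fold_class y)"
      using folded_cube_adj_iff[of "flip t y" n y] Suc.prems(2) t(1) by auto
    then show "c \<in> ?N"
      using t idx Suc.prems(3) by simp
  qed
  have "(?A ^\<^sub>m Suc k) $$ (i, j) = (\<Sum>c<?v. (?A ^\<^sub>m k) $$ (i, c) * ?A $$ (c, j))"
    using A Ak ij(1) Suc.prems(1) by (simp add: scalar_prod_def atLeast0LessThan)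
  also have "\<dots> = (\<Sum>c<?v. if folded_cube_adj (vs ! c) (vs ! j) then (?A ^\<^sub>m k) $$ (i, c) else 0)"
    using Suc.prems(1) by (intro sum.cong) (auto simp: adjacency_matrix_def)
  also have "\<dots> = (\<Sum>c\<in>?N. (?A ^\<^sub>m k) $$ (i, c))"
    by (subst sum.inter_filter[symmetric]) (auto intro: sum.cong)
  also have "\<dots> = (\<Sum>t<n. (?A ^\<^sub>m k) $$ (i, idx t))"
    unfolding N by (simp add: sum.reindex[OF inj])
  also have "\<dots> = (\<Sum>t<n. walk n k (ham x (flip t y)))"
    using Suc.IH[OF idx(1) _ idx(2)] Suc.prems(2) by simp
  also have "\<dots> = walk n (Suc k) (ham x y)"
    using sum_ham_flip[OF xy(1) Suc.prems(2), of "walk n k"] by simp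
  finally show ?case .
qed

text \<open>Every power has entries depending only on the distance of representatives, whichever are
  chosen. Quantifying over all of them lets later arguments pick convenient words.\<close>

lemma adjacency_algebra_folded_cube_iff:
  assumes n: "n \<ge> 3" and vs: "distinct vs" "set vs = folded_cube_verts n"
  shows "W \<in> adjacency_algebra (adjacency_matrix vs folded_cube_adj) \<longleftrightarrow>
    W \<in> carrier_mat (length vs) (length vs) \<and>
    (\<exists>m c. \<forall>i<length vs. \<forall>j<length vs. \<forall>x y. length x = n \<and> length y = n \<and>
      vs ! i = fold_class x \<and> vs ! j = fold_class y \<longrightarrow>
      W $$ (i, j) = (\<Sum>k<m. c k * walk n k (ham x y)))"
proof -
  have A: "adjacency_matrix vs folded_cube_adj \<in> carrier_mat (length vs) (length vs)"
    by (simp add: adjacency_matrix_def)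
  have "(W $$ (i, j) = (\<Sum>k<m. c k * (adjacency_matrix vs folded_cube_adj ^\<^sub>m k) $$ (i, j))) \<longleftrightarrow>
    (\<forall>x y. length x = n \<and> length y = n \<and> vs ! i = fold_class x \<and> vs ! j = fold_class y \<longrightarrow>
      W $$ (i, j) = (\<Sum>k<m. c k * walk n k (ham x y)))" (is "?L \<longleftrightarrow> ?R")
    if ij: "i < length vs" "j < length vs" for i j m c
  proof -
    obtain x y where xy: "length x = n" "vs ! i = fold_class x" "length y = n" "vs ! j = fold_class y"
      using vertex_rep[OF vs(2)] ij by metis
    have e: "(adjacency_matrix vs folded_cube_adj ^\<^sub>m k) $$ (i, j) = walk n k (ham x y)"
      if "length x = n" "length y = n" "vs ! i = fold_class x" "vs ! j = fold_class y" for x y k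
      using pow_adjacency_matrix_entry[OF n vs ij that] .
    show ?thesis
    proof
      assume L: ?L
      show ?R
      proof (intro allI impI, elim conjE)
        fix x y
        assume "length x = n" "length y = n" "vs ! i = fold_class x" "vs ! j = fold_class y"
        from e[OF this] show "W $$ (i, j) = (\<Sum>k<m. c k * walk n k (ham x y))"
          unfolding L by simp
      qed
    next
      assume ?R
      then have "W $$ (i, j) = (\<Sum>k<m. c k * walk n k (ham x y))"
        using xy by blast
      then show ?L using e[OF xy(1,3,2,4)] by simp
    qed
  qed
  then show ?thesis
    unfolding adjacency_algebra_iff[OF A] by (simp cong: conj_cong)
qed

section \<open>From sums over vertices to sums over words\<close>

text \<open>The vertices partition the words into pairs, since a nonempty word differs from its
  complement. Over words, single letters can then be varied freely.\<close>

lemma sum_vertices_eq_sum_words: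
  fixes f :: "nat \<Rightarrow> complex"
  assumes n: "n \<ge> 1" and vs: "distinct vs" "set vs = folded_cube_verts n"
    and f: "\<And>c z. c < length vs \<Longrightarrow> length z = n \<Longrightarrow> vs ! c = fold_class z \<Longrightarrow> f c = h z"
  shows "2 * (\<Sum>c<length vs. f c) = (\<Sum>z\<in>words n. h z)"
proof -
  have U: "words n = (\<Union>c<length vs. vs ! c)"
  proof -
    have "(\<Union>c<length vs. vs ! c) = \<Union>(set vs)"
      by (simp add: set_conv_nth lessThan_def image_def) blast
    also have "\<dots> = words n"
      unfolding vs(2) by (auto simp: folded_cube_verts_eq words_def)
    finally show ?thesis by simp
  qed
  have disj: "vs ! c \<inter> vs ! d = {}" if cd: "c < length vs" "d < length vs" "c \<noteq> d" for c d
  proof -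
    obtain x where x: "vs ! c = fold_class x"
      by (rule vertex_rep[OF vs(2) cd(1)])
    obtain y where y: "vs ! d = fold_class y"
      by (rule vertex_rep[OF vs(2) cd(2)])
    have "vs ! c \<noteq> vs ! d"
      using cd vs(1) by (simp add: nth_eq_iff_index_eq)
    then have ne: "x \<noteq> y" "x \<noteq> map Not y"
      unfolding x y fold_class_eq_iff by simp_all
    then have "map Not x \<noteq> y" "map Not x \<noteq> map Not y"
      by (metis map_Not_Not)+
    with ne show ?thesis
      unfolding x y by simp
  qed
  have fin: "finite (vs ! c)" if "c < length vs" for c
    by (rule vertex_rep[OF vs(2) that]) simp
  have "(\<Sum>z\<in>words n. h z) = (\<Sum>c<length vs. \<Sum>z\<in>vs ! c. h z)"
    unfolding U by (rule sum.UNION_disjoint) (use disj fin in auto)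
  also have "\<dots> = (\<Sum>c<length vs. 2 * f c)"
  proof (rule sum.cong[OF refl])
    fix c assume c: "c \<in> {..<length vs}"
    then obtain x where x: "length x = n" "vs ! c = fold_class x"
      using vertex_rep[OF vs(2)] by auto
    have "x \<noteq> map Not x"
      using x(1) n by (cases x) auto
    moreover have "f c = h x" "f c = h (map Not x)"
      using f[of c x] f[of c "map Not x"] c x by (auto simp: comp_def insert_commute)
    ultimately show "(\<Sum>z\<in>vs ! c. h z) = 2 * f c"
      using x(2) by simp
  qed
  finally show ?thesis
    by (simp add: sum_distrib_left)
qed

section \<open>Distance functions that come from the adjacency algebra\<close>

text \<open>These are the functions \<open>w\<close> for which the matrix with entries
  \<open>w (ham x y)\<close> lies in the algebra. Only \<open>d \<le> n\<close> occurs as a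
  distance, so nothing is asked beyond \<open>n\<close>.\<close>

definition walk_span :: "nat \<Rightarrow> (nat \<Rightarrow> complex) set" where
  "walk_span n = {w. \<exists>m c. \<forall>d\<le>n. w d = (\<Sum>k<m. c k * walk n k d)}"

lemma walk_in_walk_span: "walk n k \<in> walk_span n"
  unfolding walk_span_def
  by (auto intro!: exI[of _ "Suc k"] exI[of _ "\<lambda>j. if j = k then 1 else 0"] simp: if_distrib[of "\<lambda>u. u * _"])

lemma walk_span_cong: "w \<in> walk_span n \<Longrightarrow> (\<And>d. d \<le> n \<Longrightarrow> w' d = w d) \<Longrightarrow> w' \<in> walk_span n"
  unfolding walk_span_def by auto

lemma walk_span_scale: "w \<in> walk_span n \<Longrightarrow> (\<lambda>d. a * w d) \<in> walk_span n"
proof -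
  assume "w \<in> walk_span n"
  then obtain m c where "\<forall>d\<le>n. w d = (\<Sum>k<m. c k * walk n k d)"
    by (auto simp: walk_span_def)
  then have "\<forall>d\<le>n. a * w d = (\<Sum>k<m. (a * c k) * walk n k d)"
    by (simp add: sum_distrib_left mult.assoc)
  then show ?thesis
    unfolding walk_span_def mem_Collect_eq by (intro exI)
qed

lemma walk_span_add:
  assumes "u \<in> walk_span n" "w \<in> walk_span n"
  shows "(\<lambda>d. u d + w d) \<in> walk_span n"
proof -
  obtain l b where u: "\<And>d. d \<le> n \<Longrightarrow> u d = (\<Sum>k<l. b k * walk n k d)"
    using assms(1) by (auto simp: walk_span_def)
  obtain m c where w: "\<And>d. d \<le> n \<Longrightarrow> w d = (\<Sum>k<m. c k * walk n k d)"
    using assms(2) by (auto simp: walk_span_def)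
  have pad: "(\<Sum>k<p. f k * walk n k d) = (\<Sum>k<max l m. (if k < p then f k else 0) * walk n k d)"
    if "p \<le> max l m" for p f d
    by (rule sum.mono_neutral_cong_left) (use that in auto)
  have "u d + w d = (\<Sum>k<max l m. ((if k < l then b k else 0) + (if k < m then c k else 0)) * walk n k d)"
    if "d \<le> n" for d
    using u[OF that] w[OF that] pad[of l b d] pad[of m c d]
    by (simp add: sum.distrib distrib_right del: max.bounded_iff)
  then show ?thesis
    unfolding walk_span_def mem_Collect_eq by (intro exI allI impI)
qed

lemma walk_span_sum:
  assumes "finite S" "\<And>s. s \<in> S \<Longrightarrow> f s \<in> walk_span n"
  shows "(\<lambda>d. \<Sum>s\<in>S. f s d) \<in> walk_span n"
  using assms
proof (induction S)
  case empty
  show ?case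
    using walk_span_scale[OF walk_in_walk_span[of n 0], of 0] by simp
next
  case (insert s S)
  then show ?case
    using walk_span_add[of "f s" n "\<lambda>d. \<Sum>s\<in>S. f s d"] by simp
qed

text \<open>This is multiplication by the adjacency matrix: it sends \<open>walk n k\<close> to
  \<open>walk n (Suc k)\<close>, so the coefficients shift by one.\<close>

lemma walk_span_step:
  assumes "w \<in> walk_span n"
  shows "(\<lambda>d. of_nat d * w (d - 1) + of_nat (n - d) * w (Suc d)) \<in> walk_span n"
proof -
  obtain m c where w: "\<And>d. d \<le> n \<Longrightarrow> w d = (\<Sum>k<m. c k * walk n k d)"
    using assms by (auto simp: walk_span_def)
  have "of_nat d * w (d - 1) + of_nat (n - d) * w (Suc d) =
      (\<Sum>k<Suc m. (case k of 0 \<Rightarrow> 0 | Suc k \<Rightarrow> c k) * walk n k d)" if "d \<le> n" for d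
  proof -
    have "of_nat (n - d) * w (Suc d) = of_nat (n - d) * (\<Sum>k<m. c k * walk n k (Suc d))"
      using w[of "Suc d"] that by (cases "d = n") auto
    moreover have "w (d - 1) = (\<Sum>k<m. c k * walk n k (d - 1))"
      using w that by simp
    ultimately have "of_nat d * w (d - 1) + of_nat (n - d) * w (Suc d) =
        (\<Sum>k<m. c k * walk n (Suc k) d)"
      by (simp only: sum_distrib_left walk.simps distrib_left sum.distrib mult.left_commute)
    then show ?thesis
      by (simp only: sum.lessThan_Suc_shift nat.case mult_zero_left add_0)
  qed
  then show ?thesis
    unfolding walk_span_def mem_Collect_eq by (intro exI allI impI)
qed

lemma distance_indicator_in_walk_span:
  assumes "odd n" "2 * m < n"
  shows "(\<lambda>d. if d = m \<or> d = n - m then 1 else 0) \<in> walk_span n"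
  using assms(2)
  \<comment> \<open>One step from distance \<^term>\<open>m - 1\<close> reaches \<^term>\<open>m\<close> and \<^term>\<open>m - 2\<close>; oddness of \<^term>\<open>n\<close> keeps the
    classes \<^term>\<open>m\<close> and \<^term>\<open>n - m\<close> apart.\<close>
proof (induction m rule: less_induct)
  case (less m)
  let ?e = "\<lambda>m d. if d = m \<or> d = n - m then 1 else (0::complex)"
  show ?case
  proof (cases m)
    case 0
    show ?thesis
      using walk_in_walk_span[of n 0] by (rule walk_span_cong) (simp add: 0)
  next
    case (Suc p)
    have p: "2 * p + 3 \<le> n"
      using less.prems assms(1) Suc by presburger
    have mz: "of_nat m \<noteq> (0::complex)"
      unfolding of_nat_eq_0_iff using Suc by simp
    let ?T = "\<lambda>d. of_nat d * ?e p (d - 1) + of_nat (n - d) * ?e p (Suc d)"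
    have T: "?T \<in> walk_span n"
      by (rule walk_span_step) (use less.IH[of p] Suc p in simp)
    show ?thesis
    proof (cases p)
      case 0
      show ?thesis
        using T by (rule walk_span_cong) (use p Suc 0 in auto)
    next
      case (Suc q)
      have E: "(\<lambda>d. - of_nat (n - q) * ?e q d) \<in> walk_span n"
        by (rule walk_span_scale) (use less.IH[of q] \<open>m = Suc p\<close> p Suc in simp)
      \<comment> \<open>A word at distance \<open>m\<close> has \<open>m\<close> flips leading to
        distance \<open>p\<close>, and one at distance \<open>q\<close> has \<open>n - q\<close>.
        Hence \<open>?T\<close> is \<open>m\<close> times the indicator for \<open>m\<close> plus
        \<open>n - q\<close> times that for \<open>q\<close>, which is solved for the
        former.\<close>
      have "?e m d = (1 / of_nat m) * (?T d + - of_nat (n - q) * ?e q d)" if "d \<le> n" for d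
      proof -
        consider "d = m" | "d = n - m" | "d = q" | "d = n - q"
          | "d \<noteq> m" "d \<noteq> n - m" "d \<noteq> q" "d \<noteq> n - q" by blast
        then show ?thesis
        proof cases
          case 5
          then have "d - 1 \<noteq> p \<or> d = 0" "Suc d \<noteq> p" "d - 1 \<noteq> n - p \<or> d = 0" "Suc d \<noteq> n - p"
            using \<open>m = Suc p\<close> p Suc by auto
          then show ?thesis using 5 by auto
        qed (use \<open>m = Suc p\<close> p Suc that mz in \<open>auto simp: Suc_diff_le\<close>)
      qed
      then show ?thesis
        using walk_span_scale[OF walk_span_add[OF T E], of "1 / of_nat m"]
        by (rule walk_span_cong[rotated])
    qed
  qed
qed

text \<open>For odd \<open>n\<close> no distance is its own reflection, so the pairs
  \<open>m\<close>, \<open>n - m\<close> with \<open>2 * m < n\<close> partition the distances and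
  \<open>w\<close> is a combination of their indicators. The pair containing \<open>d\<close> has
  index \<open>r\<close>.\<close>

lemma reflection_invariant_in_walk_span:
  assumes n: "odd n" and w: "\<And>d. d \<le> n \<Longrightarrow> w (n - d) = w d"
  shows "w \<in> walk_span n"
proof -
  let ?S = "{m. 2 * m < n}"
  let ?e = "\<lambda>m d. if d = m \<or> d = n - m then 1 else (0::complex)"
  have fin: "finite ?S"
    by (rule finite_subset[of _ "{..n}"]) auto
  have "(\<lambda>d. \<Sum>m\<in>?S. w m * ?e m d) \<in> walk_span n"
    by (rule walk_span_sum[OF fin], rule walk_span_scale, rule distance_indicator_in_walk_span)
      (use n in auto)
  moreover have "w d = (\<Sum>m\<in>?S. w m * ?e m d)" if d: "d \<le> n" for d
  proof -
    define r where "r = min d (n - d)"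
    have ne: "d \<noteq> n - d"
    proof
      assume "d = n - d"
      then have "n = 2 * d" using d by simp
      then show False using n by simp
    qed
    have r: "r \<in> ?S" "w r = w d"
      using ne d w[OF d] by (auto simp: r_def min_def)
    have "(\<Sum>m\<in>?S. w m * ?e m d) = (\<Sum>m\<in>?S. if m = r then w m else 0)"
      by (rule sum.cong[OF refl]) (use d ne in \<open>auto simp: r_def min_def\<close>)
    also have "\<dots> = w d"
      using r fin by simp
    finally show ?thesis by simp
  qed
  ultimately show ?thesis
    by (rule walk_span_cong)
qed

section \<open>Orthogonality at distance two forces alternation, hence odd \<open>n\<close>\<close>

lemma ham_Cons: "ham (a # x) (b # z) = (if a = b then 0 else 1) + ham x z"
proof -
  have "{i. i < length (a # x) \<and> (a # x) ! i \<noteq> (b # z) ! i} =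
      (if a = b then {} else {0}) \<union> Suc ` {i. i < length x \<and> x ! i \<noteq> z ! i}"
    by (auto simp: nth_Cons' image_iff Suc_pred split: if_splits) (metis Suc_pred less_Suc_eq_0_disj not_less_eq)+
  then show ?thesis
    unfolding ham_def by (simp add: card_image)
qed

lemma ex_word_with_ham:
  assumes "k \<le> n"
  shows "\<exists>z. length z = n \<and> ham (replicate n False) z = k"
proof (intro exI conjI)
  let ?z = "map (\<lambda>i. i < k) [0..<n]"
  show "length ?z = n" by simp
  have "{i. i < length (replicate n False) \<and> replicate n False ! i \<noteq> ?z ! i} = {..<k}"
    using assms by auto
  then show "ham (replicate n False) ?z = k"
    by (simp add: ham_def)
qed

lemma sum_words_Suc:
  "(\<Sum>z\<in>words (Suc n). f z) = (\<Sum>z\<in>words n. f (True # z) + f (False # z) :: complex)"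
proof -
  have "words (Suc n) = Cons True ` words n \<union> Cons False ` words n"
    by (auto simp: words_def length_Suc_conv image_iff)
  moreover have "Cons True ` words n \<inter> Cons False ` words n = {}"
    by auto
  ultimately have "(\<Sum>z\<in>words (Suc n). f z) = sum f (Cons True ` words n) + sum f (Cons False ` words n)"
    by (simp only: sum.union_disjoint finite_imageI finite_words)
  then show ?thesis
    by (simp add: sum.reindex sum.distrib)
qed

text \<open>On the unit circle \<open>1 / q\<close> is the conjugate of \<open>q\<close>, so the
  real part is \<open>2 * (Re q + 1)\<close>; it vanishes only at \<open>q = -1\<close>.\<close>

lemma unimodular_sum_inverse:
  fixes q :: complex
  assumes "cmod q = 1"
  shows "0 \<le> Re (q + 1 / q + 2)" "Re (q + 1 / q + 2) = 0 \<Longrightarrow> q = -1"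
proof -
  have "1 / q = cnj q"
    using assms by (metis complex_div_cnj div_by_1 mult_1 of_real_1 one_power2)
  then have R: "Re (q + 1 / q + 2) = 2 * (Re q + 1)"
    by simp
  show "0 \<le> Re (q + 1 / q + 2)"
    unfolding R using abs_Re_le_cmod[of q] assms by simp
  assume "Re (q + 1 / q + 2) = 0"
  then have "Re q = -1"
    unfolding R by simp
  moreover have "(Re q)\<^sup>2 + (Im q)\<^sup>2 = 1"
    using assms by (simp add: cmod_power2[symmetric])
  ultimately show "q = -1"
    by (simp add: complex_eq_iff)
qed

text \<open>Grouping the words by their first two letters turns the orthogonality relation into a sum
  of terms \<^term>\<open>q + 1 / q + 2\<close> with unimodular \<^term>\<open>q\<close>; their real parts are nonnegative, so all
  of them vanish.\<close>

lemma alternating_if_orthogonal: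
  assumes w: "\<And>d. d \<le> Suc (Suc p) \<Longrightarrow> cmod (w d) = 1"
    and orth: "(\<Sum>z\<in>words (Suc (Suc p)). w (ham (False # False # replicate p False) z) /
      w (ham (True # True # replicate p False) z)) = 0"
    and k: "k \<le> p"
  shows "w (Suc (Suc k)) = - w k"
proof -
  let ?h = "ham (replicate p False)"
  let ?q = "\<lambda>z. w (Suc (Suc (?h z))) / w (?h z)"
  have nz: "w d \<noteq> 0" if "d \<le> Suc (Suc p)" for d
    using w[OF that] by auto
  have h: "?h z \<le> p" for z
    using ham_le[of "replicate p False" z] by simp
  have q: "cmod (?q z) = 1" for z
    using w h[of z] by (simp add: norm_divide)
  \<comment> \<open>Initial letters True, True give \<open>?q z\<close> and False, False give its
    inverse. The two mixed beginnings are at equal distance from both words and give 1 each.\<close>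
  have "(\<Sum>z\<in>words p. ?q z + 1 / ?q z + 2) =
      (\<Sum>z\<in>words (Suc (Suc p)). w (ham (False # False # replicate p False) z) /
        w (ham (True # True # replicate p False) z))"
    unfolding sum_words_Suc ham_Cons
    by (rule sum.cong[OF refl]) (use nz h in \<open>simp add: le_SucI\<close>)
  then have "(\<Sum>z\<in>words p. ?q z + 1 / ?q z + 2) = 0"
    using orth by simp
  then have "(\<Sum>z\<in>words p. Re (?q z + 1 / ?q z + 2)) = 0"
    by (simp only: Re_sum[symmetric] zero_complex.sel)
  then have "\<forall>z\<in>words p. Re (?q z + 1 / ?q z + 2) = 0"
    using unimodular_sum_inverse(1)[OF q] by (subst (asm) sum_nonneg_eq_0_iff) auto
  then have "?q z = -1" if "z \<in> words p" for z
    using unimodular_sum_inverse(2)[OF q] that by blast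
  moreover obtain z where "length z = p" "?h z = k"
    using ex_word_with_ham[OF k] by auto
  ultimately have "w (Suc (Suc k)) / w k = -1"
    by (auto simp: words_def)
  then show ?thesis
    using nz[of k] k by (simp add: divide_eq_eq)
qed

lemma alternating_iterate:
  assumes "\<And>k. Suc (Suc k) \<le> n \<Longrightarrow> w (Suc (Suc k)) = - w k" "j + 2 * i \<le> n"
  shows "w (j + 2 * i) = (-1) ^ i * (w j :: complex)"
  using assms(2)
proof (induction i)
  case (Suc i)
  then show ?case using assms(1)[of "j + 2 * i"] by simp
qed simp

text \<open>If \<open>n = 2 * p\<close>, steps of two from 0 to \<open>n\<close> give the sign
  \<open>(-1) ^ p\<close>, and from 1 to \<open>n - 1\<close> the opposite sign. Reflection would
  make both equal to 1.\<close>

lemma odd_if_alternating_reflection_invariant: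
  fixes w :: "nat \<Rightarrow> complex"
  assumes alt: "\<And>k. Suc (Suc k) \<le> n \<Longrightarrow> w (Suc (Suc k)) = - w k"
    and refl: "\<And>d. d \<le> n \<Longrightarrow> w (n - d) = w d"
    and nz: "w 0 \<noteq> 0" "w 1 \<noteq> 0" and n: "n \<ge> 2"
  shows "odd n"
proof
  assume "even n"
  then obtain p where p: "n = 2 * p" by (elim evenE)
  have "n - 1 = 1 + 2 * (p - 1)"
    using p n by simp
  then have "w n = (-1) ^ p * w 0" "w (n - 1) = (-1) ^ (p - 1) * w 1"
    using alternating_iterate[of n w 0 p] alternating_iterate[of n w 1 "p - 1"] alt p n
    by auto
  then have "(-1) ^ p = (1::complex)" "(-1) ^ (p - 1) = (1::complex)"
    using refl[of 0] refl[of 1] nz n by auto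
  moreover have "p = Suc (p - 1)" using p n by simp
  ultimately show False
    by (metis mult_1_right power_Suc one_neq_neg_one)
qed

section \<open>Alternation implies orthogonality\<close>

text \<open>Two flips change the distance by 2 if the words agree at both positions or differ at
  both; otherwise the changes cancel.\<close>

lemma alternating_flip_flip:
  fixes w :: "nat \<Rightarrow> complex"
  assumes alt: "\<And>k. Suc (Suc k) \<le> length x \<Longrightarrow> w (Suc (Suc k)) = - w k"
    and len: "length x = length z" "i < length z" "j < length z" "i \<noteq> j"
  shows "w (ham x (flip i (flip j z))) =
    (if (x ! i = z ! i) = (x ! j = z ! j) then - w (ham x z) else w (ham x z))"
proof -
  let ?z = "flip j z"
  have le: "ham x u \<le> length x" for u
    by (rule ham_le)
  have zi: "?z ! i = z ! i" using len by simp
  consider "x ! i = z ! i" "x ! j = z ! j" | "x ! i = z ! i" "x ! j \<noteq> z ! j"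
    | "x ! i \<noteq> z ! i" "x ! j = z ! j" | "x ! i \<noteq> z ! i" "x ! j \<noteq> z ! j" by blast
  then show ?thesis
  proof cases
    case 1
    then have "ham x (flip i ?z) = Suc (Suc (ham x z))"
      using ham_flip_eq[of x z j] ham_flip_eq[of x ?z i] len zi by simp
    then show ?thesis using 1 alt[of "ham x z"] le[of "flip i ?z"] by simp
  next
    case 2
    then have "ham x (flip i ?z) = ham x z"
      using ham_flip_neq[of x z j] ham_flip_eq[of x ?z i] len zi by simp
    then show ?thesis using 2 by simp
  next
    case 3
    then have "ham x (flip i ?z) = ham x z"
      using ham_flip_eq[of x z j] ham_flip_neq[of x ?z i] len zi by simp
    then show ?thesis using 3 by simp
  next
    case 4
    then have "ham x z = Suc (Suc (ham x (flip i ?z)))"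
      using ham_flip_neq[of x z j] ham_flip_neq[of x ?z i] len zi by simp
    then show ?thesis using 4 alt[of "ham x (flip i ?z)"] le[of z] by simp
  qed
qed

text \<open>If \<^term>\<open>x\<close> and \<^term>\<open>y\<close> differ at \<^term>\<open>i\<close> and agree at \<^term>\<open>j\<close>, flipping both letters is
  an involution that changes the sign of exactly one of the two weights.\<close>

lemma orthogonal_if_alternating:
  fixes w :: "nat \<Rightarrow> complex"
  assumes alt: "\<And>k. Suc (Suc k) \<le> n \<Longrightarrow> w (Suc (Suc k)) = - w k"
    and len: "length x = n" "length y = n" and ne: "x \<noteq> y" "x \<noteq> map Not y"
  shows "(\<Sum>z\<in>words n. w (ham x z) / w (ham y z)) = 0"
proof -
  obtain i where i: "i < n" "x ! i \<noteq> y ! i"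
    using ne(1) len by (auto simp: list_eq_iff_nth_eq)
  obtain j where j: "j < n" "x ! j = y ! j"
    using ne(2) len by (auto simp: list_eq_iff_nth_eq)
  have ij: "i \<noteq> j" using i j by auto
  let ?F = "\<lambda>z. flip i (flip j z)"
  let ?f = "\<lambda>z. w (ham x z) / w (ham y z)"
  have F: "?F (?F z) = z" "?F z \<in> words n" if "z \<in> words n" for z
    using that i j ij by (auto simp: words_def list_eq_iff_nth_eq nth_list_update)
  have "?f (?F z) = - ?f z" if "z \<in> words n" for z
  proof -
    have lz: "length z = n" using that by (simp add: words_def)
    have "w (ham u (?F z)) = (if (u ! i = z ! i) = (u ! j = z ! j) then - w (ham u z) else w (ham u z))"
      if "length u = n" for u
      using alternating_flip_flip[of u w z i j] alt that lz i j ij by auto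
    from this[OF len(1)] this[OF len(2)] i(2) j(2) show ?thesis
      by (auto split: if_splits)
  qed
  then have "(\<Sum>z\<in>words n. ?f (?F z)) = - (\<Sum>z\<in>words n. ?f z)"
    by (simp add: sum_negf)
  moreover have "(\<Sum>z\<in>words n. ?f (?F z)) = (\<Sum>z\<in>words n. ?f z)"
    by (rule sum.reindex_bij_witness[of _ ?F ?F]) (use F in auto)
  ultimately show ?thesis
    by (simp add: eq_neg_iff_add_eq_0)
qed

section \<open>The two directions of the equivalence\<close>

lemma odd_if_complex_hadamard:
  assumes n: "n \<ge> 3" and vs: "distinct vs" "set vs = folded_cube_verts n"
    and W: "W \<in> adjacency_algebra (adjacency_matrix vs folded_cube_adj)" "complex_hadamard W"
  shows "odd n"
proof -
  obtain m c where dim: "dim_row W = length vs"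
    and c: "\<And>i j x y. i < length vs \<Longrightarrow> j < length vs \<Longrightarrow> length x = n \<Longrightarrow> length y = n \<Longrightarrow>
      vs ! i = fold_class x \<Longrightarrow> vs ! j = fold_class y \<Longrightarrow>
      W $$ (i, j) = (\<Sum>k<m. c k * walk n k (ham x y))"
    using W(1) unfolding adjacency_algebra_folded_cube_iff[OF n vs] by blast
  define w where "w d = (\<Sum>k<m. c k * walk n k d)" for d
  note Ww = c[folded w_def]
  have refl: "w (n - d) = w d" if "d \<le> n" for d
    using walk_reflect[OF that] by (simp add: w_def)
  \<comment> \<open>Every distance up to \<open>n\<close> is realised by some pair of words, so the
    condition on the entries reaches every value of \<open>w\<close>.\<close>
  have unit: "cmod (w d) = 1" if d: "d \<le> n" for d
  proof -
    obtain z where z: "length z = n" "ham (replicate n False) z = d"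
      using ex_word_with_ham[OF d] by auto
    obtain i where i: "i < length vs" "vs ! i = fold_class (replicate n False)"
      using vertex_index[OF vs(2), of "replicate n False"] by auto
    obtain j where j: "j < length vs" "vs ! j = fold_class z"
      using vertex_index[OF vs(2) z(1)] by auto
    have "cmod (W $$ (i, j)) = 1"
      using W(2) dim i j by (auto simp: complex_hadamard_def)
    then show ?thesis
      using Ww[OF i(1) j(1) _ z(1) i(2) j(2)] z(2) by simp
  qed
  define p where "p = n - 2"
  have p: "n = Suc (Suc p)" "p > 0"
    using n by (auto simp: p_def)
  \<comment> \<open>These words are at distance 2. As \<open>p > 0\<close> they share a letter, so
    they are not complementary and give different rows.\<close>
  let ?x = "False # False # replicate p False" and ?y = "True # True # replicate p False"
  obtain i where i: "i < length vs" "vs ! i = fold_class ?x"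
    using vertex_index[OF vs(2), of ?x] p by auto
  obtain j where j: "j < length vs" "vs ! j = fold_class ?y"
    using vertex_index[OF vs(2), of ?y] p by auto
  have "?x \<noteq> ?y" "?x \<noteq> map Not ?y"
    using p(2) by (cases p; simp)+
  then have "fold_class ?x \<noteq> fold_class ?y"
    using fold_class_eq_iff[of ?x ?y] by blast
  then have "vs ! i \<noteq> vs ! j"
    unfolding i(2) j(2) .
  then have "i \<noteq> j"
    by blast
  then have "(\<Sum>d<length vs. W $$ (i, d) / W $$ (j, d)) = 0"
    using W(2) i(1) j(1) dim by (auto simp: complex_hadamard_def type_II_def)
  moreover have "2 * (\<Sum>d<length vs. W $$ (i, d) / W $$ (j, d)) =
      (\<Sum>z\<in>words n. w (ham ?x z) / w (ham ?y z))"
    by (rule sum_vertices_eq_sum_words[OF _ vs])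
      (use n p Ww[OF i(1) _ _ _ i(2)] Ww[OF j(1) _ _ _ j(2)] in auto)
  ultimately have orth: "(\<Sum>z\<in>words (Suc (Suc p)). w (ham ?x z) / w (ham ?y z)) = 0"
    using p by simp
  have alt: "w (Suc (Suc k)) = - w k" if "Suc (Suc k) \<le> n" for k
    using alternating_if_orthogonal[OF _ orth, of k] unit p that by auto
  have "w 0 \<noteq> 0" "w 1 \<noteq> 0"
    using unit[of 0] unit[of 1] n by auto
  then show ?thesis
    using odd_if_alternating_reflection_invariant[of n w] alt refl n by auto
qed

lemma complex_hadamard_if_odd:
  assumes n: "n \<ge> 3" "odd n" and vs: "distinct vs" "set vs = folded_cube_verts n"
  shows "\<exists>W \<in> adjacency_algebra (adjacency_matrix vs folded_cube_adj). complex_hadamard W"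
proof -
  \<comment> \<open>Setting \<open>w 0 = 1\<close> and alternating fixes the even distances.
    Reflection swaps parity as \<open>n\<close> is odd, and so fixes the odd ones.\<close>
  define w :: "nat \<Rightarrow> complex" where "w d = (-1) ^ ((if even d then d else n - d) div 2)" for d
  have alt: "w (Suc (Suc k)) = - w k" if "Suc (Suc k) \<le> n" for k
  proof (cases "even k")
    case False
    have "n - k = Suc (Suc (n - Suc (Suc k)))"
      using that by simp
    then have "(n - k) div 2 = Suc ((n - Suc (Suc k)) div 2)"
      by simp
    then show ?thesis using False by (simp add: w_def)
  qed (simp add: w_def)
  have refl: "w (n - d) = w d" if "d \<le> n" for d
    using that n(2) by (auto simp: w_def)
  have unit: "cmod (w d) = 1" for d
    by (simp add: w_def norm_power)
  have nz: "w d \<noteq> 0" for d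
    by (simp add: w_def)
  obtain m c where mc: "\<And>d. d \<le> n \<Longrightarrow> w d = (\<Sum>k<m. c k * walk n k d)"
    using reflection_invariant_in_walk_span[of n w, OF n(2) refl] by (auto simp: walk_span_def)
  \<comment> \<open>The choice of representatives does not affect the entries of the matrix, because
    \<open>w\<close> is invariant under reflection.\<close>
  define rep where "rep i = (SOME x. length x = n \<and> vs ! i = fold_class x)" for i
  have rep: "length (rep i) = n" "vs ! i = fold_class (rep i)" if "i < length vs" for i
    using vertex_rep[OF vs(2) that] someI_ex[of "\<lambda>x. length x = n \<and> vs ! i = fold_class x"]
    unfolding rep_def by blast+
  define W where "W = mat (length vs) (length vs) (\<lambda>(i, j). w (ham (rep i) (rep j)))"
  have W: "W $$ (i, j) = w (ham x y)"
    if ij: "i < length vs" "j < length vs" and xy: "length x = n" "length y = n"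
      "vs ! i = fold_class x" "vs ! j = fold_class y" for i j x y
  proof -
    have not2: "w (ham a (map Not b)) = w (ham a b)" if "length a = n" "length b = n" for a b
      using that ham_map_Not[of a b] refl[of "ham a b"] ham_le[of a b] by simp
    have not1: "w (ham (map Not a) b) = w (ham a b)" if "length a = n" "length b = n" for a b
      using not2[of b a] that ham_commute[of "map Not a" b] ham_commute[of a b] by simp
    have "fold_class x = fold_class (rep i)" "fold_class y = fold_class (rep j)"
      using rep(2) ij xy by simp_all
    then have "x = rep i \<or> x = map Not (rep i)" "y = rep j \<or> y = map Not (rep j)"
      by (simp_all only: fold_class_eq_iff)
    then show ?thesis
      using ij rep(1) not1 not2 by (auto simp: W_def)
  qed
  have "W \<in> adjacency_algebra (adjacency_matrix vs folded_cube_adj)"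
    unfolding adjacency_algebra_folded_cube_iff[OF n(1) vs]
  proof (intro conjI exI[of _ m] exI[of _ c] allI impI, goal_cases)
    case 1
    show ?case by (simp add: W_def)
  next
    case (2 i j x y)
    then have "W $$ (i, j) = w (ham x y)"
      using W by blast
    also have "\<dots> = (\<Sum>k<m. c k * walk n k (ham x y))"
      using 2 ham_le[of x y] by (intro mc) simp
    finally show ?case .
  qed
  moreover have "complex_hadamard W"
  proof -
    have dim: "dim_row W = length vs" "dim_col W = length vs"
      by (simp_all add: W_def)
    have "(\<Sum>d<length vs. W $$ (a, d) / W $$ (b, d)) = (if a = b then of_nat (length vs) else 0)"
      if ab: "a < length vs" "b < length vs" for a b
    proof (cases "a = b")
      case True
      then show ?thesis
        using ab nz by (simp add: W_def)
    next
      case False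
      then have "vs ! a \<noteq> vs ! b"
        using ab vs(1) by (simp add: nth_eq_iff_index_eq)
      then have "fold_class (rep a) \<noteq> fold_class (rep b)"
        using rep(2) ab by simp
      then have "rep a \<noteq> rep b" "rep a \<noteq> map Not (rep b)"
        using fold_class_eq_iff[of "rep a" "rep b"] by blast+
      then have "(\<Sum>z\<in>words n. w (ham (rep a) z) / w (ham (rep b) z)) = 0"
        using rep(1) ab alt by (intro orthogonal_if_alternating) auto
      moreover have "2 * (\<Sum>d<length vs. W $$ (a, d) / W $$ (b, d)) =
          (\<Sum>z\<in>words n. w (ham (rep a) z) / w (ham (rep b) z))"
        by (rule sum_vertices_eq_sum_words[OF _ vs])
          (use n W[OF ab(1) _ rep(1)[OF ab(1)] _ rep(2)[OF ab(1)]]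
            W[OF ab(2) _ rep(1)[OF ab(2)] _ rep(2)[OF ab(2)]] in auto)
      ultimately show ?thesis using False by simp
    qed
    then show ?thesis
      using dim nz unit by (auto simp: complex_hadamard_def type_II_def W_def)
  qed
  ultimately show ?thesis by blast
qed

theorem theorem6p2:
  fixes n :: nat and vs :: "bool list set list"
  assumes "n \<ge> 3" and "distinct vs" and "set vs = folded_cube_verts n"
  shows "(\<exists>W \<in> adjacency_algebra (adjacency_matrix vs folded_cube_adj). complex_hadamard W)
    \<longleftrightarrow> odd n"
  using odd_if_complex_hadamard complex_hadamard_if_odd assms by blast

end
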